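(* Let $p$ be a prime, let $\mathbb F$ be a field of characteristic $p$, and let $\lambda\in\mathbb F^p$. If $p=2$, then $H^2(\mathfrak m_0^\lambda(2))\cong C^2(\mathfrak m_0^\lambda(2))=\operatorname{span}(\{e^{1,2}\})$ is $1$-dimensional. If $p\ge 3$, then $$\dim H^2(\mathfrak m_0^\lambda(p))=\frac{p+1}{2},$$ and the cohomology classes of the cocycles $\{e^{1,p},\phi_5,\phi_7,\phi_9,\dots,\phi_{p+2}\}$ form a basis, where for odd $k$ with $5\le k\le p+2$ $$\phi_k=e^{2,k-2}-e^{3,k-3}+\cdots+(-1)^{\lfloor k/2\rfloor}e^{\lfloor k/2\rfloor,\,k-\lfloor k/2\rfloor}=\sum_{i=2}^{\lfloor k/2\rfloor}(-1)^i e^{i,k-i}.$$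
   Context: Let $\mathbb F$ be a field of characteristic $p>0$. $\mathfrak m_0(p)$ is the Lie algebra over $\mathbb F$ with basis $e_1,\dots,e_p$ and brackets $[e_1,e_i]=-[e_i,e_1]=e_{i+1}$ for $1<i<p$, all other brackets of basis elements being $0$. For $\lambda=(\lambda_1,\dots,\lambda_p)\in\mathbb F^p$, $\mathfrak m_0^\lambda(p)$ denotes $\mathfrak m_0(p)$ with the restricted structure $\left(\sum_k\alpha_ke_k\right)^{[p]}=\left(\sum_k\alpha_k^p\lambda_k\right)e_p$; ordinary cohomology depends only on the underlying Lie algebra $\mathfrak m_0(p)$. Write $\mathfrak g=\mathfrak m_0^\lambda(p)$. Ordinary Lie algebra cohomology with trivial coefficients $\mathbb F$: $C^n(\mathfrak g)=(\wedge^n\mathfrak g)^*$; $\{e^k\}$ is the basis of $\mathfrak g^*$ dual to $\{e_k\}$, and $\{e^{i,j}: 1\le i<j\le p\}$ is the basis of $C^2(\mathfrak g)$ dual to $\{e_i\wedge e_j\}$. The differentials are $d^1(\psi)(g,h)=\psi([g,h])$ and $d^2(\phi)(g,h,f)=\phi([g,h]\wedge f)-\phi([g,f]\wedge h)+\phi([h,f]\wedge g)$, and $H^2(\mathfrak g)=\ker d^2/\operatorname{im}d^1$. *)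

theory Defs
  imports "Jordan_Normal_Form.VS_Connect" "HOL-Algebra.AbelCoset"
begin

record ('a, 'b) lie_algebra = "('a, 'b) module" +
  bracket :: "'b \<Rightarrow> 'b \<Rightarrow> 'b"

record ('a, 'b) restricted_lie_algebra = "('a, 'b) lie_algebra" +
  p_map :: "'b \<Rightarrow> 'b"

locale lie_algebra = vectorspace K L
  for K :: "('a, 'k) ring_scheme" and L :: "('a, 'b, 'l) lie_algebra_scheme" +
  assumes bracket_closed:
      "\<lbrakk>x \<in> carrier L; y \<in> carrier L\<rbrakk> \<Longrightarrow> bracket L x y \<in> carrier L"
    and bracket_add_left:
      "\<lbrakk>x \<in> carrier L; y \<in> carrier L; z \<in> carrier L\<rbrakk> \<Longrightarrow>
        bracket L (x \<oplus>\<^bsub>L\<^esub> y) z = bracket L x z \<oplus>\<^bsub>L\<^esub> bracket L y z"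
    and bracket_add_right:
      "\<lbrakk>x \<in> carrier L; y \<in> carrier L; z \<in> carrier L\<rbrakk> \<Longrightarrow>
        bracket L x (y \<oplus>\<^bsub>L\<^esub> z) = bracket L x y \<oplus>\<^bsub>L\<^esub> bracket L x z"
    and bracket_smult_left:
      "\<lbrakk>c \<in> carrier K; x \<in> carrier L; y \<in> carrier L\<rbrakk> \<Longrightarrow>
        bracket L (c \<odot>\<^bsub>L\<^esub> x) y = c \<odot>\<^bsub>L\<^esub> bracket L x y"
    and bracket_smult_right:
      "\<lbrakk>c \<in> carrier K; x \<in> carrier L; y \<in> carrier L\<rbrakk> \<Longrightarrow>
        bracket L x (c \<odot>\<^bsub>L\<^esub> y) = c \<odot>\<^bsub>L\<^esub> bracket L x y"
    and bracket_self: "x \<in> carrier L \<Longrightarrow> bracket L x x = \<zero>\<^bsub>L\<^esub>"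
    and jacobi:
      "\<lbrakk>x \<in> carrier L; y \<in> carrier L; z \<in> carrier L\<rbrakk> \<Longrightarrow>
        bracket L x (bracket L y z) \<oplus>\<^bsub>L\<^esub> bracket L y (bracket L z x)
          \<oplus>\<^bsub>L\<^esub> bracket L z (bracket L x y) = \<zero>\<^bsub>L\<^esub>"

text \<open>
  Elements of $(\wedge^n \mathfrak g)^*$ are represented by alternating $n$-linear forms on
  $\mathfrak g$, the value at $x_1 \wedge \dots \wedge x_n$ being the value of the form at
  $(x_1, \dots, x_n)$. Alternating means vanishing on repeated arguments, which matters in
  characteristic 2. HOL functions being total, a form is set to 0 off the carrier,
  so that equal forms are equal functions.
\<close>

definition cochains1 :: "('a::field, 'b, 'l) lie_algebra_scheme \<Rightarrow> ('b \<Rightarrow> 'a) set" where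
  "cochains1 L = {\<psi>.
     (\<forall>x\<in>carrier L. \<forall>y\<in>carrier L. \<psi> (x \<oplus>\<^bsub>L\<^esub> y) = \<psi> x + \<psi> y) \<and>
     (\<forall>c. \<forall>x\<in>carrier L. \<psi> (c \<odot>\<^bsub>L\<^esub> x) = c * \<psi> x) \<and>
     (\<forall>x. x \<notin> carrier L \<longrightarrow> \<psi> x = 0)}"

definition alternating_forms2 ::
    "('a::field, 'b, 'l) lie_algebra_scheme \<Rightarrow> ('b \<Rightarrow> 'b \<Rightarrow> 'a) set" where
  "alternating_forms2 L = {\<phi>.
     (\<forall>x\<in>carrier L. \<forall>y\<in>carrier L. \<forall>z\<in>carrier L. \<phi> (x \<oplus>\<^bsub>L\<^esub> y) z = \<phi> x z + \<phi> y z) \<and>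
     (\<forall>x\<in>carrier L. \<forall>y\<in>carrier L. \<forall>z\<in>carrier L. \<phi> x (y \<oplus>\<^bsub>L\<^esub> z) = \<phi> x y + \<phi> x z) \<and>
     (\<forall>c. \<forall>x\<in>carrier L. \<forall>y\<in>carrier L. \<phi> (c \<odot>\<^bsub>L\<^esub> x) y = c * \<phi> x y) \<and>
     (\<forall>c. \<forall>x\<in>carrier L. \<forall>y\<in>carrier L. \<phi> x (c \<odot>\<^bsub>L\<^esub> y) = c * \<phi> x y) \<and>
     (\<forall>x\<in>carrier L. \<phi> x x = 0) \<and>
     (\<forall>x y. x \<notin> carrier L \<or> y \<notin> carrier L \<longrightarrow> \<phi> x y = 0)}"

definition cochains2 ::
    "('a::field, 'b, 'l) lie_algebra_scheme \<Rightarrow> ('a, 'b \<Rightarrow> 'b \<Rightarrow> 'a) module" where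
  "cochains2 L = \<lparr>carrier = alternating_forms2 L, mult = undefined, one = undefined,
     zero = (\<lambda>_ _. 0), add = (\<lambda>\<phi> \<chi> x y. \<phi> x y + \<chi> x y), smult = (\<lambda>c \<phi> x y. c * \<phi> x y)\<rparr>"

definition d1 :: "('a::field, 'b, 'l) lie_algebra_scheme \<Rightarrow> ('b \<Rightarrow> 'a) \<Rightarrow> 'b \<Rightarrow> 'b \<Rightarrow> 'a" where
  "d1 L \<psi> = (\<lambda>g h. if g \<in> carrier L \<and> h \<in> carrier L then \<psi> (bracket L g h) else 0)"

definition d2 ::
    "('a::field, 'b, 'l) lie_algebra_scheme \<Rightarrow> ('b \<Rightarrow> 'b \<Rightarrow> 'a) \<Rightarrow> 'b \<Rightarrow> 'b \<Rightarrow> 'b \<Rightarrow> 'a" where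
  "d2 L \<phi> = (\<lambda>g h f. if g \<in> carrier L \<and> h \<in> carrier L \<and> f \<in> carrier L
     then \<phi> (bracket L g h) f - \<phi> (bracket L g f) h + \<phi> (bracket L h f) g else 0)"

definition cocycles2 :: "('a::field, 'b, 'l) lie_algebra_scheme \<Rightarrow> ('b \<Rightarrow> 'b \<Rightarrow> 'a) set" where
  "cocycles2 L = {\<phi> \<in> carrier (cochains2 L). d2 L \<phi> = (\<lambda>_ _ _. 0)}"

definition coboundaries2 :: "('a::field, 'b, 'l) lie_algebra_scheme \<Rightarrow> ('b \<Rightarrow> 'b \<Rightarrow> 'a) set" where
  "coboundaries2 L = d1 L ` cochains1 L"

definition quotient_module ::
    "('a, 'b, 'm) module_scheme \<Rightarrow> 'b set \<Rightarrow> ('a, 'b set) module" where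
  "quotient_module M N = \<lparr>carrier = a_rcosets\<^bsub>M\<^esub> N, mult = undefined, one = undefined,
     zero = N, add = set_add M, smult = (\<lambda>c X. \<Union>x\<in>X. N +>\<^bsub>M\<^esub> (c \<odot>\<^bsub>M\<^esub> x))\<rparr>"

definition H2 ::
    "('a::field, 'b, 'l) lie_algebra_scheme \<Rightarrow> ('a, ('b \<Rightarrow> 'b \<Rightarrow> 'a) set) module" where
  "H2 L = quotient_module ((cochains2 L)\<lparr>carrier := cocycles2 L\<rparr>) (coboundaries2 L)"

definition cohomology_class ::
    "('a::field, 'b, 'l) lie_algebra_scheme \<Rightarrow> ('b \<Rightarrow> 'b \<Rightarrow> 'a) \<Rightarrow> ('b \<Rightarrow> 'b \<Rightarrow> 'a) set" where
  "cohomology_class L \<phi> = coboundaries2 L +>\<^bsub>cochains2 L\<^esub> \<phi>"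

definition isomorphic_spaces ::
    "('a::field, 'b, 'm) module_scheme \<Rightarrow> ('a, 'c, 'n) module_scheme \<Rightarrow> bool" where
  "isomorphic_spaces V W \<longleftrightarrow>
     (\<exists>T. linear_map class_ring V W T \<and> bij_betw T (carrier V) (carrier W))"

text \<open>
  The underlying space is the library space of vectors of length $p$, whose entries are
  indexed from 0; thus the coordinate of $x$ at $e_k$ is \<open>x $ (k - 1)\<close> for $1 \le k \le p$.
\<close>

definition m0_basis :: "nat \<Rightarrow> nat \<Rightarrow> 'a::field vec" where
  "m0_basis p k = unit_vec p (k - 1)"

definition m0_basis_bracket :: "nat \<Rightarrow> nat \<Rightarrow> nat \<Rightarrow> 'a::field vec" where
  "m0_basis_bracket p i j =
     (if i = 1 \<and> 1 < j \<and> j < p then m0_basis p (j + 1)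
      else if j = 1 \<and> 1 < i \<and> i < p then - m0_basis p (i + 1)
      else 0\<^sub>v p)"

definition m0_bracket :: "nat \<Rightarrow> 'a::field vec \<Rightarrow> 'a vec \<Rightarrow> 'a vec" where
  "m0_bracket p x y = vec p (\<lambda>m. \<Sum>i=1..p. \<Sum>j=1..p.
     x $ (i - 1) * y $ (j - 1) * m0_basis_bracket p i j $ m)"

definition m0_p_map :: "nat \<Rightarrow> 'a::field vec \<Rightarrow> 'a vec \<Rightarrow> 'a vec" where
  "m0_p_map p lam x = (\<Sum>k=1..p. (x $ (k - 1)) ^ p * lam $ (k - 1)) \<cdot>\<^sub>v m0_basis p p"

definition m0 :: "nat \<Rightarrow> 'a::field vec \<Rightarrow> ('a, 'a vec) restricted_lie_algebra" where
  "m0 p lam = \<lparr>carrier = carrier_vec p, mult = undefined, one = undefined,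
     zero = 0\<^sub>v p, add = (+), smult = (\<cdot>\<^sub>v),
     bracket = m0_bracket p, p_map = m0_p_map p lam\<rparr>"

text \<open>The form $e^{i,j}$ takes $x \wedge y$ to its coefficient at $e_i \wedge e_j$.\<close>

definition e2 :: "nat \<Rightarrow> nat \<Rightarrow> nat \<Rightarrow> 'a::field vec \<Rightarrow> 'a vec \<Rightarrow> 'a" where
  "e2 p i j = (\<lambda>x y. if x \<in> carrier_vec p \<and> y \<in> carrier_vec p
     then x $ (i - 1) * y $ (j - 1) - x $ (j - 1) * y $ (i - 1) else 0)"

definition phi :: "nat \<Rightarrow> nat \<Rightarrow> 'a::field vec \<Rightarrow> 'a vec \<Rightarrow> 'a" where
  "phi p k = (\<lambda>x y. \<Sum>i=2..k div 2. (- 1) ^ i * e2 p i (k - i) x y)"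

lemma m0_bracket_basis:
  assumes "i \<in> {1..p}" "j \<in> {1..p}"
  shows "m0_bracket p (m0_basis p i) (m0_basis p j) = (m0_basis_bracket p i j :: 'a::field vec)"
proof (rule eq_vecI)
  fix m assume "m < dim_vec (m0_basis_bracket p i j :: 'a vec)"
  then have m: "m < p"
    by (auto simp: m0_basis_bracket_def m0_basis_def split: if_splits)
  have "(m0_bracket p (m0_basis p i) (m0_basis p j) :: 'a vec) $ m =
    (\<Sum>i'=1..p. \<Sum>j'=1..p. if i' = i then if j' = j then m0_basis_bracket p i' j' $ m else 0 else 0)"
    unfolding m0_bracket_def using m assms
    by (auto simp: m0_basis_def intro!: sum.cong)
  also have "\<dots> = (\<Sum>i'=1..p. if i' = i then
      (\<Sum>j'=1..p. if j' = j then m0_basis_bracket p i' j' $ m else 0) else 0)"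
    by (intro sum.cong) auto
  also have "\<dots> = m0_basis_bracket p i j $ m"
    using assms by simp
  finally show "(m0_bracket p (m0_basis p i) (m0_basis p j) :: 'a vec) $ m =
    m0_basis_bracket p i j $ m" .
qed (auto simp: m0_bracket_def m0_basis_bracket_def m0_basis_def)

lemma e2_dual_basis:
  assumes "1 \<le> i" "i < j" "j \<le> p" "1 \<le> k" "k < l" "l \<le> p"
  shows "e2 p i j (m0_basis p k) (m0_basis p l) = (if i = k \<and> j = l then 1 else 0 :: 'a::field)"
  using assms by (auto simp: e2_def m0_basis_def)

lemma m0_bracket_index:
  fixes x y :: "'a::field vec"
  assumes m: "m < p"
  shows "m0_bracket p x y $ m =
    (if 2 \<le> m then x $ 0 * y $ (m - 1) - x $ (m - 1) * y $ 0 else 0)"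
proof -
  have *: "x $ (i - 1) * y $ (j - 1) * (m0_basis_bracket p i j $ m) =
      (if i = 1 then if j = m then if 2 \<le> m then x $ 0 * y $ (m - 1) else 0 else 0 else 0)
    - (if i = m then if j = 1 then if 2 \<le> m then x $ (m - 1) * y $ 0 else 0 else 0 else 0)"
    if "i \<in> {1..p}" "j \<in> {1..p}" for i j
    using that m by (auto simp: m0_basis_bracket_def m0_basis_def)
  have ins: "(\<Sum>j=1..p. if P then f j else (0::'a)) = (if P then \<Sum>j=1..p. f j else 0)" for P f
    by simp
  have "m0_bracket p x y $ m = (\<Sum>i=1..p. \<Sum>j=1..p.
      (if i = 1 then if j = m then if 2 \<le> m then x $ 0 * y $ (m - 1) else 0 else 0 else 0)
    - (if i = m then if j = 1 then if 2 \<le> m then x $ (m - 1) * y $ 0 else 0 else 0 else 0))"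
    unfolding m0_bracket_def index_vec[OF m] by (intro sum.cong refl *)
  also have "\<dots> = (if 2 \<le> m then x $ 0 * y $ (m - 1) - x $ (m - 1) * y $ 0 else 0)"
    using m unfolding sum_subtractf ins by simp
  finally show ?thesis .
qed

lemma lie_algebra_m0: "lie_algebra class_ring (m0 p (lam :: 'a::field vec))"
proof -
  have "\<exists>y\<in>carrier_vec p. y + x = 0\<^sub>v p" if "x \<in> carrier_vec p" for x :: "'a vec"
    using that by (intro bexI[of _ "- x"]) auto
  then have ag: "abelian_group (m0 p lam)"
    by (intro abelian_groupI) (auto simp: m0_def)
  have md: "module class_ring (m0 p lam)"
    by (intro moduleI class_cring.cring_axioms ag)
      (auto simp: m0_def add_smult_distrib_vec smult_add_distrib_vec smult_smult_assoc)
  have vs: "vectorspace class_ring (m0 p lam)"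
    by (intro vectorspace.intro class_field.field_axioms md)
  have closed: "m0_bracket p x y \<in> carrier_vec p" for x y :: "'a vec"
    by (simp add: m0_bracket_def)
  have dim: "dim_vec (m0_bracket p x y) = p" for x y :: "'a vec"
    by (simp add: m0_bracket_def)
  show ?thesis
    by (intro lie_algebra.intro lie_algebra_axioms.intro vs)
      (simp_all add: m0_def closed,
       (rule eq_vecI; auto simp: dim m0_bracket_index algebra_simps)+)
qed

lemma module_quotient_module:
  assumes "module R M" and "Module.submodule N R M"
  shows "module R (quotient_module M N)"
proof -
  interpret M: Module.module R M by (rule assms)
  interpret N: Module.submodule N R M by (rule assms)
  interpret A: abelian_subgroup N M
    by (intro abelian_subgroupI3 additive_subgroupI N.subgroup_axioms M.abelian_group_axioms)
  have smult: "(\<Union>y\<in>N +>\<^bsub>M\<^esub> x. N +>\<^bsub>M\<^esub> (c \<odot>\<^bsub>M\<^esub> y)) = N +>\<^bsub>M\<^esub> (c \<odot>\<^bsub>M\<^esub> x)"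
    if c: "c \<in> carrier R" and x: "x \<in> carrier M" for c x
  proof -
    have "N +>\<^bsub>M\<^esub> (c \<odot>\<^bsub>M\<^esub> y) = N +>\<^bsub>M\<^esub> (c \<odot>\<^bsub>M\<^esub> x)" if "y \<in> N +>\<^bsub>M\<^esub> x" for y
    proof -
      from that obtain h where h: "h \<in> N" "y = h \<oplus>\<^bsub>M\<^esub> x"
        by (auto simp: a_r_coset_def')
      have "c \<odot>\<^bsub>M\<^esub> y = c \<odot>\<^bsub>M\<^esub> h \<oplus>\<^bsub>M\<^esub> c \<odot>\<^bsub>M\<^esub> x"
        using h c x A.a_Hcarr by (simp add: M.smult_r_distr)
      moreover have "c \<odot>\<^bsub>M\<^esub> h \<in> N"
        using h c by (simp add: N.smult_closed)
      ultimately have "c \<odot>\<^bsub>M\<^esub> y \<in> N +>\<^bsub>M\<^esub> (c \<odot>\<^bsub>M\<^esub> x)"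
        by (auto simp: a_r_coset_def')
      then show ?thesis
        using c x A.a_repr_independence' by blast
    qed
    moreover have "x \<in> N +>\<^bsub>M\<^esub> x"
      using x by (rule A.a_rcos_self)
    ultimately show ?thesis by blast
  qed
  have cos: "\<exists>x\<in>carrier M. X = N +>\<^bsub>M\<^esub> x" if "X \<in> carrier (quotient_module M N)" for X
    using that by (auto simp: quotient_module_def A_RCOSETS_def')
  have simps: "N +>\<^bsub>M\<^esub> x \<in> carrier (quotient_module M N)"
      "c \<in> carrier R \<Longrightarrow> c \<odot>\<^bsub>quotient_module M N\<^esub> (N +>\<^bsub>M\<^esub> x) = N +>\<^bsub>M\<^esub> (c \<odot>\<^bsub>M\<^esub> x)"
      "y \<in> carrier M \<Longrightarrow>
        (N +>\<^bsub>M\<^esub> x) \<oplus>\<^bsub>quotient_module M N\<^esub> (N +>\<^bsub>M\<^esub> y) = N +>\<^bsub>M\<^esub> (x \<oplus>\<^bsub>M\<^esub> y)"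
    if "x \<in> carrier M" for c x y
    using that by (auto simp: quotient_module_def A_RCOSETS_def' smult A.a_rcos_sum)
  have zero: "\<zero>\<^bsub>quotient_module M N\<^esub> = N +>\<^bsub>M\<^esub> \<zero>\<^bsub>M\<^esub>"
    using A.a_subset by (simp add: quotient_module_def M.a_coset_add_zero)
  have inv: "\<exists>Y\<in>carrier (quotient_module M N).
      Y \<oplus>\<^bsub>quotient_module M N\<^esub> (N +>\<^bsub>M\<^esub> x) = N +>\<^bsub>M\<^esub> \<zero>\<^bsub>M\<^esub>" if "x \<in> carrier M" for x
    using that by (intro bexI[of _ "N +>\<^bsub>M\<^esub> (\<ominus>\<^bsub>M\<^esub> x)"]) (simp_all add: simps M.l_neg)
  have ag: "abelian_group (quotient_module M N)"
    by (intro abelian_groupI)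
      (auto dest!: cos simp: simps zero inv M.a_ac)
  show ?thesis
    by (intro moduleI M.R.cring_axioms ag)
      (auto dest!: cos simp: simps M.smult_l_distr M.smult_r_distr M.smult_assoc1)
qed

lemma module_cochains2_subset:
  assumes "\<And>\<phi> \<chi>. \<phi> \<in> Z \<Longrightarrow> \<chi> \<in> Z \<Longrightarrow> (\<lambda>x y. \<phi> x y + \<chi> x y) \<in> Z"
    and sm: "\<And>c \<phi>. \<phi> \<in> Z \<Longrightarrow> (\<lambda>x y. c * \<phi> x y) \<in> Z"
    and "(\<lambda>_ _. 0) \<in> Z"
  shows "module class_ring ((cochains2 L)\<lparr>carrier := Z\<rparr>)"
proof -
  have neg: "\<exists>\<chi>\<in>Z. (\<lambda>x y. \<chi> x y + \<phi> x y) = (\<lambda>_ _. 0)" if "\<phi> \<in> Z" for \<phi>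
    using sm[OF that, of "-1"] by (intro bexI[of _ "\<lambda>x y. -1 * \<phi> x y"]) auto
  have ag: "abelian_group ((cochains2 L)\<lparr>carrier := Z\<rparr>)"
    using assms neg by (intro abelian_groupI) (simp_all add: cochains2_def algebra_simps)
  show ?thesis
    using assms by (intro moduleI class_cring.cring_axioms ag)
      (simp_all add: cochains2_def algebra_simps)
qed

lemma vectorspace_cochains2: "vectorspace class_ring (cochains2 L)"
proof -
  have "module class_ring ((cochains2 L)\<lparr>carrier := alternating_forms2 L\<rparr>)"
    by (rule module_cochains2_subset) (simp_all add: alternating_forms2_def algebra_simps)
  then show ?thesis
    by (intro vectorspace.intro class_field.field_axioms) (simp add: cochains2_def)
qed

lemma vectorspace_H2:
  assumes "lie_algebra class_ring L"
  shows "vectorspace class_ring (H2 L)"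
proof -
  interpret lie_algebra class_ring L by (rule assms)
  let ?Z = "(cochains2 L)\<lparr>carrier := cocycles2 L\<rparr>"
  have Z: "module class_ring ?Z"
  proof (rule module_cochains2_subset)
    fix \<phi> \<chi> assume *: "\<phi> \<in> cocycles2 L" "\<chi> \<in> cocycles2 L"
    have "d2 L (\<lambda>x y. \<phi> x y + \<chi> x y) = (\<lambda>g h f. d2 L \<phi> g h f + d2 L \<chi> g h f)"
      by (simp add: d2_def fun_eq_iff)
    with * show "(\<lambda>x y. \<phi> x y + \<chi> x y) \<in> cocycles2 L"
      by (simp add: cocycles2_def cochains2_def alternating_forms2_def algebra_simps)
  next
    fix c \<phi> assume *: "\<phi> \<in> cocycles2 L"
    have "d2 L (\<lambda>x y. c * \<phi> x y) = (\<lambda>g h f. c * d2 L \<phi> g h f)"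
      by (simp add: d2_def fun_eq_iff algebra_simps)
    with * show "(\<lambda>x y. c * \<phi> x y) \<in> cocycles2 L"
      by (simp add: cocycles2_def cochains2_def alternating_forms2_def algebra_simps)
  qed (simp add: cocycles2_def cochains2_def alternating_forms2_def d2_def fun_eq_iff)
  interpret Z: Module.module class_ring ?Z by (rule Z)
  have B: "d1 L \<psi> \<in> cocycles2 L" if \<psi>: "\<psi> \<in> cochains1 L" for \<psi>
  proof -
    have \<psi>_add: "\<psi> (x \<oplus>\<^bsub>L\<^esub> y) = \<psi> x + \<psi> y" if "x \<in> carrier L" "y \<in> carrier L" for x y
      using \<psi> that by (simp add: cochains1_def)
    have \<psi>_smult: "\<psi> (c \<odot>\<^bsub>L\<^esub> x) = c * \<psi> x" if "x \<in> carrier L" for c x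
      using \<psi> that by (simp add: cochains1_def)
    have \<psi>_zero: "\<psi> \<zero>\<^bsub>L\<^esub> = 0"
      using \<psi>_add[of "\<zero>\<^bsub>L\<^esub>" "\<zero>\<^bsub>L\<^esub>"] M.zero_closed M.r_zero add_cancel_right_right by metis
    have anti: "bracket L x y \<oplus>\<^bsub>L\<^esub> bracket L y x = \<zero>\<^bsub>L\<^esub>"
      if "x \<in> carrier L" "y \<in> carrier L" for x y
      using bracket_self[of "y \<oplus>\<^bsub>L\<^esub> x"] that
      by (simp add: bracket_add_left bracket_add_right bracket_closed
          bracket_self[of x] bracket_self[of y])
    have \<psi>_anti: "\<psi> (bracket L x y) = - \<psi> (bracket L y x)"
      if "x \<in> carrier L" "y \<in> carrier L" for x y
      using arg_cong[OF anti[OF that], of \<psi>] that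
      by (simp add: \<psi>_add \<psi>_zero bracket_closed eq_neg_iff_add_eq_0)
    have \<psi>_anti2: "\<psi> (bracket L x (bracket L y z)) = - \<psi> (bracket L x (bracket L z y))"
      if "x \<in> carrier L" "y \<in> carrier L" "z \<in> carrier L" for x y z
    proof -
      have "\<psi> (bracket L x (bracket L y z \<oplus>\<^bsub>L\<^esub> bracket L z y)) = \<psi> (bracket L x (\<zero>\<^bsub>L\<^esub> \<oplus>\<^bsub>L\<^esub> \<zero>\<^bsub>L\<^esub>))"
        using that by (simp add: anti)
      also have "\<psi> (bracket L x (\<zero>\<^bsub>L\<^esub> \<oplus>\<^bsub>L\<^esub> \<zero>\<^bsub>L\<^esub>)) = 0"
        using bracket_smult_right[of 0 x "\<zero>\<^bsub>L\<^esub>"] \<psi>_smult[of "bracket L x \<zero>\<^bsub>L\<^esub>" 0] that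
        by (simp add: bracket_closed)
      finally show ?thesis
        using that
        by (simp add: \<psi>_add bracket_add_right bracket_closed eq_neg_iff_add_eq_0)
    qed
    have "d1 L \<psi> \<in> alternating_forms2 L"
      by (auto simp: alternating_forms2_def d1_def bracket_add_left bracket_add_right
          bracket_smult_left bracket_smult_right bracket_self bracket_closed
          \<psi>_add \<psi>_smult \<psi>_zero)
    moreover have "\<psi> (bracket L (bracket L g h) f) - \<psi> (bracket L (bracket L g f) h)
        + \<psi> (bracket L (bracket L h f) g) = 0"
      if [simp]: "g \<in> carrier L" "h \<in> carrier L" "f \<in> carrier L" for g h f
    proof -
      have "\<psi> (bracket L g (bracket L h f)) + \<psi> (bracket L h (bracket L f g))
          + \<psi> (bracket L f (bracket L g h)) = 0"
        using arg_cong[OF jacobi[of g h f], of \<psi>] by (simp add: \<psi>_add \<psi>_zero bracket_closed)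
      moreover have "\<psi> (bracket L (bracket L g h) f) = - \<psi> (bracket L f (bracket L g h))"
        and "\<psi> (bracket L (bracket L g f) h) = - \<psi> (bracket L h (bracket L g f))"
        and "\<psi> (bracket L (bracket L h f) g) = - \<psi> (bracket L g (bracket L h f))"
        by (rule \<psi>_anti; simp add: bracket_closed)+
      moreover have "\<psi> (bracket L h (bracket L g f)) = - \<psi> (bracket L h (bracket L f g))"
        by (rule \<psi>_anti2) simp_all
      ultimately show ?thesis
        by (simp add: algebra_simps neg_eq_iff_add_eq_0)
    qed
    ultimately show ?thesis
      by (simp add: cocycles2_def cochains2_def d2_def d1_def bracket_closed fun_eq_iff)
  qed
  have add: "\<phi> \<oplus>\<^bsub>?Z\<^esub> \<chi> \<in> coboundaries2 L"
    if "\<phi> \<in> coboundaries2 L" "\<chi> \<in> coboundaries2 L" for \<phi> \<chi>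
  proof -
    from that obtain \<psi> \<theta> where *: "\<phi> = d1 L \<psi>" "\<chi> = d1 L \<theta>" "\<psi> \<in> cochains1 L" "\<theta> \<in> cochains1 L"
      by (auto simp: coboundaries2_def)
    then have "(\<lambda>x. \<psi> x + \<theta> x) \<in> cochains1 L"
      by (simp add: cochains1_def algebra_simps)
    moreover have "\<phi> \<oplus>\<^bsub>?Z\<^esub> \<chi> = d1 L (\<lambda>x. \<psi> x + \<theta> x)"
      by (simp add: * cochains2_def d1_def fun_eq_iff)
    ultimately show ?thesis
      by (simp add: coboundaries2_def)
  qed
  have smult: "c \<odot>\<^bsub>?Z\<^esub> \<phi> \<in> coboundaries2 L" if "\<phi> \<in> coboundaries2 L" for c \<phi>
  proof -
    from that obtain \<psi> where *: "\<phi> = d1 L \<psi>" "\<psi> \<in> cochains1 L"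
      by (auto simp: coboundaries2_def)
    then have "(\<lambda>x. c * \<psi> x) \<in> cochains1 L"
      by (simp add: cochains1_def algebra_simps)
    moreover have "c \<odot>\<^bsub>?Z\<^esub> \<phi> = d1 L (\<lambda>x. c * \<psi> x)"
      by (simp add: * cochains2_def d1_def fun_eq_iff)
    ultimately show ?thesis
      by (simp add: coboundaries2_def)
  qed
  have sub: "coboundaries2 L \<subseteq> carrier ?Z"
    using B by (auto simp: coboundaries2_def)
  have "(\<lambda>_. 0) \<in> cochains1 L" "d1 L (\<lambda>_. 0) = \<zero>\<^bsub>?Z\<^esub>"
    by (simp_all add: cochains1_def d1_def cochains2_def fun_eq_iff)
  then have zero: "\<zero>\<^bsub>?Z\<^esub> \<in> coboundaries2 L"
    by (metis coboundaries2_def image_eqI)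
  have minus: "\<ominus>\<^bsub>?Z\<^esub> \<phi> \<in> coboundaries2 L" if "\<phi> \<in> coboundaries2 L" for \<phi>
  proof -
    have "\<ominus>\<^bsub>?Z\<^esub> \<phi> = (- 1) \<odot>\<^bsub>?Z\<^esub> \<phi>"
      using Z.smult_l_minus[of 1 \<phi>] Z.smult_one[of \<phi>] that sub
      by (auto simp: class_ring_simps)
    then show ?thesis
      using smult[OF that] by simp
  qed
  have "Module.submodule (coboundaries2 L) class_ring ?Z"
    by (intro Z.submoduleI sub zero minus add smult)
  then show ?thesis
    unfolding H2_def
    by (intro vectorspace.intro class_field.field_axioms module_quotient_module Z)
qed

end

theory Submission
  imports Defs
begin

text \<open>
  Write $a_{i,j} = \phi(e_i, e_j)$. A 2-cochain $\phi$ is a cocycle iff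
  $a_{i+1,j} + a_{i,j+1} = 0$ for $2 \le i, j \le p$ (with $a_{i,p+1} = a_{p+1,j} = 0$), while the
  $a_{1,j}$ are unconstrained. So on each antidiagonal $i + j = k$ with $i, j \ge 2$ the values
  alternate in sign; they vanish if $k$ is even, because the antidiagonal meets the diagonal, and if
  $k > p + 2$, because it runs into the boundary. For each odd $k$ with $5 \le k \le p + 2$ one
  parameter remains, and it belongs to $\phi_k$. The coboundaries are spanned by
  $e^{1,2}, \dots, e^{1,p-1}$. Hence the functionals $\phi \mapsto a_{1,p}$ and
  $\phi \mapsto a_{2,j}$, for odd $j$ with $3 \le j \le p$, vanish on coboundaries, are dual to the
  classes of $e^{1,p}$ and $\phi_{j+2}$, and jointly detect nontrivial classes.
\<close>

section \<open>Bases detected by dual functionals\<close>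

text \<open>Applying \<open>f i\<close> to a linear combination of the \<open>b j\<close> reads off
  the coefficient of \<open>b i\<close>, which gives independence. For spanning, \<open>x\<close>
  minus the combination with coefficients \<open>f i x\<close> is killed by every functional, hence
  is zero by \<open>ker\<close>. Duality also makes \<open>b\<close> injective on \<open>I\<close>,
  so the basis has \<open>card I\<close> elements.\<close>

lemma basis_of_dual_functionals:
  fixes V :: "('a::field, 'b, 'm) module_scheme" and f :: "'i \<Rightarrow> 'b \<Rightarrow> 'a"
  assumes V: "vectorspace class_ring V" and finI: "finite I" and b: "b ` I \<subseteq> carrier V"
    and add: "\<And>i x y. \<lbrakk>i \<in> I; x \<in> carrier V; y \<in> carrier V\<rbrakk> \<Longrightarrow> f i (x \<oplus>\<^bsub>V\<^esub> y) = f i x + f i y"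
    and smult: "\<And>i c x. \<lbrakk>i \<in> I; x \<in> carrier V\<rbrakk> \<Longrightarrow> f i (c \<odot>\<^bsub>V\<^esub> x) = c * f i x"
    and dual: "\<And>i j. \<lbrakk>i \<in> I; j \<in> I\<rbrakk> \<Longrightarrow> f i (b j) = (if i = j then 1 else 0)"
    and ker: "\<And>x. \<lbrakk>x \<in> carrier V; \<And>i. i \<in> I \<Longrightarrow> f i x = 0\<rbrakk> \<Longrightarrow> x = \<zero>\<^bsub>V\<^esub>"
  shows "vectorspace.basis class_ring V (b ` I)" and "vectorspace.dim class_ring V = card I"
proof -
  interpret vectorspace class_ring V by (rule V)
  have zero: "f i \<zero>\<^bsub>V\<^esub> = 0" if "i \<in> I" for i
    using smult[of i "\<zero>\<^bsub>V\<^esub>" 0] lmult_0[of "\<zero>\<^bsub>V\<^esub>"] that by simp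
  have inj: "inj_on b I"
    using dual by (metis inj_onI one_neq_zero)
  have comb: "f i (lincomb a A) = (\<Sum>v\<in>A. a v * f i v)"
    if "finite A" "A \<subseteq> carrier V" "i \<in> I" for a A i
    using that(1,2)
  proof (induction A)
    case empty
    then show ?case using that(3) by (simp add: lincomb_def zero)
  next
    case (insert v A)
    have "lincomb a (insert v A) = a v \<odot>\<^bsub>V\<^esub> v \<oplus>\<^bsub>V\<^esub> lincomb a A"
      using insert.prems insert.hyps lincomb_insert[of A a v] by simp
    moreover have "lincomb a A \<in> carrier V"
      using insert.prems by (intro lincomb_closed) auto
    ultimately show ?case
      using insert that(3) by (simp add: add smult)
  qed
  have comb_b: "f i (lincomb a (b ` I)) = a (b i)" if "i \<in> I" for a i
  proof -
    have "f i (lincomb a (b ` I)) = (\<Sum>j\<in>I. a (b j) * f i (b j))"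
      using comb[of "b ` I" i a] finI b that by (simp add: sum.reindex inj)
    also have "\<dots> = (\<Sum>j\<in>I. if j = i then a (b j) else 0)"
      using that by (intro sum.cong) (auto simp: dual)
    finally show ?thesis using finI that by simp
  qed
  have "lin_indpt (b ` I)"
    by (rule finite_lin_indpt2) (use finI b comb_b zero in \<open>auto, metis\<close>)
  moreover have "x \<in> span (b ` I)" if x: "x \<in> carrier V" for x
  proof -
    \<comment> \<open>Coefficients are indexed by vectors, not by \<open>I\<close>; since
      \<open>b\<close> is injective on \<open>I\<close>, the coefficient at \<open>b i\<close> is
      \<open>f i x\<close>.\<close>
    define a where "a = (\<lambda>v. f (inv_into I b v) x)"
    let ?y = "lincomb a (b ` I)"
    have y: "?y \<in> carrier V"
      using b by (intro lincomb_closed) auto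
    have "f i ((-1) \<odot>\<^bsub>V\<^esub> ?y \<oplus>\<^bsub>V\<^esub> x) = 0" if "i \<in> I" for i
      using that x y comb_b[OF that, of a] inj by (simp add: add smult a_def)
    then have "(-1) \<odot>\<^bsub>V\<^esub> ?y \<oplus>\<^bsub>V\<^esub> x = \<zero>\<^bsub>V\<^esub>"
      using x y by (intro ker) auto
    moreover have "(-1) \<odot>\<^bsub>V\<^esub> ?y = \<ominus>\<^bsub>V\<^esub> ?y"
      using smult_l_minus[of 1 ?y] smult_one[of ?y] y by (simp add: class_ring_simps)
    ultimately have "x = ?y"
      using x y by (metis M.minus_equality M.minus_minus M.a_inv_closed)
    then show ?thesis
      using finI b by (auto simp: finite_span)
  qed
  ultimately show basis: "basis (b ` I)"
    using b span_is_subset2[of "b ` I"] by (auto simp: basis_def)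
  show "dim = card I"
    using dim_basis[OF _ basis] finI inj by (simp add: card_image)
qed

section \<open>Cohomology classes and the operations of \<open>H2\<close> on representatives\<close>

lemma coboundaries2_add:
  assumes "\<beta> \<in> coboundaries2 L" "\<gamma> \<in> coboundaries2 L"
  shows "(\<lambda>x y. \<beta> x y + \<gamma> x y) \<in> coboundaries2 L"
proof -
  from assms obtain \<psi> \<theta> where *: "\<beta> = d1 L \<psi>" "\<gamma> = d1 L \<theta>" "\<psi> \<in> cochains1 L" "\<theta> \<in> cochains1 L"
    by (auto simp: coboundaries2_def)
  then have "(\<lambda>x. \<psi> x + \<theta> x) \<in> cochains1 L"
    by (simp add: cochains1_def algebra_simps)
  moreover have "(\<lambda>x y. \<beta> x y + \<gamma> x y) = d1 L (\<lambda>x. \<psi> x + \<theta> x)"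
    by (simp add: * d1_def fun_eq_iff)
  ultimately show ?thesis by (simp add: coboundaries2_def)
qed

lemma coboundaries2_smult:
  assumes "\<beta> \<in> coboundaries2 L"
  shows "(\<lambda>x y. c * \<beta> x y) \<in> coboundaries2 L"
proof -
  from assms obtain \<psi> where *: "\<beta> = d1 L \<psi>" "\<psi> \<in> cochains1 L"
    by (auto simp: coboundaries2_def)
  then have "(\<lambda>x. c * \<psi> x) \<in> cochains1 L"
    by (simp add: cochains1_def algebra_simps)
  moreover have "(\<lambda>x y. c * \<beta> x y) = d1 L (\<lambda>x. c * \<psi> x)"
    by (simp add: * d1_def fun_eq_iff)
  ultimately show ?thesis by (simp add: coboundaries2_def)
qed

lemma coboundaries2_zero: "(\<lambda>_ _. 0) \<in> coboundaries2 L"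
proof -
  have "(\<lambda>_. 0) \<in> cochains1 L" "d1 L (\<lambda>_. 0) = (\<lambda>_ _. 0)"
    by (simp_all add: cochains1_def d1_def fun_eq_iff)
  then show ?thesis by (metis coboundaries2_def image_eqI)
qed

lemma cohomology_class_iff:
  "\<chi> \<in> cohomology_class L \<phi> \<longleftrightarrow> (\<lambda>x y. \<chi> x y - \<phi> x y) \<in> coboundaries2 L"
proof
  assume "\<chi> \<in> cohomology_class L \<phi>"
  then obtain \<beta> where "\<beta> \<in> coboundaries2 L" "\<chi> = (\<lambda>x y. \<beta> x y + \<phi> x y)"
    by (auto simp: cohomology_class_def a_r_coset_def' cochains2_def)
  then show "(\<lambda>x y. \<chi> x y - \<phi> x y) \<in> coboundaries2 L" by simp
next
  assume "(\<lambda>x y. \<chi> x y - \<phi> x y) \<in> coboundaries2 L"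
  then show "\<chi> \<in> cohomology_class L \<phi>"
    by (force simp: cohomology_class_def a_r_coset_def' cochains2_def)
qed

lemma cohomology_class_self: "\<phi> \<in> cohomology_class L \<phi>"
  by (simp add: cohomology_class_iff coboundaries2_zero)

lemma cohomology_class_cong:
  assumes "\<chi> \<in> cohomology_class L \<phi>"
  shows "cohomology_class L \<chi> = cohomology_class L \<phi>"
proof -
  have *: "(\<lambda>x y. \<chi> x y - \<phi> x y) \<in> coboundaries2 L"
    using assms by (simp add: cohomology_class_iff)
  have "\<theta> \<in> cohomology_class L \<chi> \<longleftrightarrow> \<theta> \<in> cohomology_class L \<phi>" for \<theta>
    using coboundaries2_add[OF _ *, of "\<lambda>x y. \<theta> x y - \<chi> x y"]
      coboundaries2_add[OF _ coboundaries2_smult[OF *, of "-1"], of "\<lambda>x y. \<theta> x y - \<phi> x y"]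
    by (auto simp: cohomology_class_iff)
  then show ?thesis by blast
qed

lemma cohomology_class_zero: "cohomology_class L (\<lambda>_ _. 0) = coboundaries2 L"
  by (auto simp: cohomology_class_iff)

lemma carrier_H2: "carrier (H2 L) = cohomology_class L ` cocycles2 L"
  by (auto simp: H2_def quotient_module_def A_RCOSETS_def' cohomology_class_def a_r_coset_def'
      cochains2_def)

lemma zero_H2: "\<zero>\<^bsub>H2 L\<^esub> = coboundaries2 L"
  by (simp add: H2_def quotient_module_def)

lemma add_H2:
  "cohomology_class L \<phi> \<oplus>\<^bsub>H2 L\<^esub> cohomology_class L \<chi> = cohomology_class L (\<lambda>x y. \<phi> x y + \<chi> x y)"
proof -
  have "cohomology_class L \<phi> \<oplus>\<^bsub>H2 L\<^esub> cohomology_class L \<chi> =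
      {\<lambda>x y. \<phi>' x y + \<chi>' x y |\<phi>' \<chi>'. \<phi>' \<in> cohomology_class L \<phi> \<and> \<chi>' \<in> cohomology_class L \<chi>}"
    by (auto simp: H2_def quotient_module_def set_add_def' cochains2_def)
  also have "\<dots> = cohomology_class L (\<lambda>x y. \<phi> x y + \<chi> x y)"
  proof (intro equalityI subsetI)
    fix \<theta> assume "\<theta> \<in> cohomology_class L (\<lambda>x y. \<phi> x y + \<chi> x y)"
    then have "(\<lambda>x y. \<theta> x y - \<chi> x y) \<in> cohomology_class L \<phi>"
      by (simp add: cohomology_class_iff algebra_simps)
    then show "\<theta> \<in> {\<lambda>x y. \<phi>' x y + \<chi>' x y |\<phi>' \<chi>'. \<phi>' \<in> cohomology_class L \<phi> \<and> \<chi>' \<in> cohomology_class L \<chi>}"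
      using cohomology_class_self[of \<chi> L] by force
  next
    fix \<theta> assume "\<theta> \<in> {\<lambda>x y. \<phi>' x y + \<chi>' x y |\<phi>' \<chi>'. \<phi>' \<in> cohomology_class L \<phi> \<and> \<chi>' \<in> cohomology_class L \<chi>}"
    then show "\<theta> \<in> cohomology_class L (\<lambda>x y. \<phi> x y + \<chi> x y)"
      by (auto simp: cohomology_class_iff algebra_simps dest: coboundaries2_add)
  qed
  finally show ?thesis .
qed

text \<open>The scalar multiple in \<open>quotient_module\<close> is a union of cosets over all
  representatives. Multiples of coboundaries are coboundaries, so these cosets all coincide and the
  union collapses to one of them, also for \<open>c = 0\<close>.\<close>

lemma smult_H2:
  "c \<odot>\<^bsub>H2 L\<^esub> cohomology_class L \<phi> = cohomology_class L (\<lambda>x y. c * \<phi> x y)"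
proof -
  have *: "cohomology_class L (\<lambda>x y. c * \<chi> x y) = cohomology_class L (\<lambda>x y. c * \<phi> x y)"
    if "\<chi> \<in> cohomology_class L \<phi>" for \<chi>
    using that coboundaries2_smult[of "\<lambda>x y. \<chi> x y - \<phi> x y" L c]
    by (intro cohomology_class_cong) (simp add: cohomology_class_iff algebra_simps)
  have "c \<odot>\<^bsub>H2 L\<^esub> cohomology_class L \<phi> =
      (\<Union>\<chi>\<in>cohomology_class L \<phi>. cohomology_class L (\<lambda>x y. c * \<chi> x y))"
    by (simp add: H2_def quotient_module_def cohomology_class_def a_r_coset_def' cochains2_def)
  also have "\<dots> = (\<Union>\<chi>\<in>cohomology_class L \<phi>. cohomology_class L (\<lambda>x y. c * \<phi> x y))"
    by (intro SUP_cong refl *)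
  finally show ?thesis
    using cohomology_class_self[of \<phi> L] by blast
qed

text \<open>Functionals on cochains that vanish on coboundaries descend to \<open>H2 L\<close>.
  Duality survives the passage to classes, and \<open>ker\<close> says that the descended
  functionals separate classes from zero, so the criterion for dual functionals applies.\<close>

lemma H2_basis_of_dual_functionals:
  fixes L :: "('a::field, 'b, 'l) lie_algebra_scheme" and F :: "'i \<Rightarrow> ('b \<Rightarrow> 'b \<Rightarrow> 'a) \<Rightarrow> 'a"
  assumes L: "lie_algebra class_ring L" and finI: "finite I" and b: "b ` I \<subseteq> cocycles2 L"
    and add: "\<And>i \<phi> \<chi>. i \<in> I \<Longrightarrow> F i (\<lambda>x y. \<phi> x y + \<chi> x y) = F i \<phi> + F i \<chi>"
    and smult: "\<And>i c \<phi>. i \<in> I \<Longrightarrow> F i (\<lambda>x y. c * \<phi> x y) = c * F i \<phi>"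
    and cobd: "\<And>i \<beta>. \<lbrakk>i \<in> I; \<beta> \<in> coboundaries2 L\<rbrakk> \<Longrightarrow> F i \<beta> = 0"
    and dual: "\<And>i j. \<lbrakk>i \<in> I; j \<in> I\<rbrakk> \<Longrightarrow> F i (b j) = (if i = j then 1 else 0)"
    and ker: "\<And>\<phi>. \<lbrakk>\<phi> \<in> cocycles2 L; \<And>i. i \<in> I \<Longrightarrow> F i \<phi> = 0\<rbrakk> \<Longrightarrow> \<phi> \<in> coboundaries2 L"
  shows "vectorspace.basis class_ring (H2 L) (cohomology_class L ` b ` I)"
    and "vectorspace.dim class_ring (H2 L) = card I"
proof -
  \<comment> \<open>The descended functional evaluates \<open>F i\<close> at a chosen
    representative; the choice is harmless because two representatives differ by a coboundary, which
    \<open>F i\<close> kills.\<close>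
  define f where "f i X = F i (SOME \<phi>. \<phi> \<in> X)" for i X
  have f: "f i (cohomology_class L \<phi>) = F i \<phi>" if "i \<in> I" for i \<phi>
  proof -
    define \<chi> where "\<chi> = (SOME \<chi>. \<chi> \<in> cohomology_class L \<phi>)"
    have "\<chi> \<in> cohomology_class L \<phi>"
      unfolding \<chi>_def using cohomology_class_self[of \<phi> L] someI[of "\<lambda>\<chi>. \<chi> \<in> cohomology_class L \<phi>"] by blast
    then have "F i (\<lambda>x y. \<chi> x y - \<phi> x y) = 0"
      using cobd that by (simp add: cohomology_class_iff)
    then have "F i \<chi> = F i \<phi>"
      using add[OF that, of "\<lambda>x y. \<chi> x y - \<phi> x y" \<phi>] by simp
    then show ?thesis by (simp add: f_def \<chi>_def)
  qed
  note H2 = vectorspace_H2[OF L]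
  have cls: "(cohomology_class L \<circ> b) ` I \<subseteq> carrier (H2 L)"
    using b by (auto simp: carrier_H2)
  have *: "f i (X \<oplus>\<^bsub>H2 L\<^esub> Y) = f i X + f i Y" "f i (c \<odot>\<^bsub>H2 L\<^esub> X) = c * f i X"
    if "i \<in> I" "X \<in> carrier (H2 L)" "Y \<in> carrier (H2 L)" for i X Y c
    using that by (auto simp: carrier_H2 add_H2 smult_H2 f add smult)
  have **: "X = \<zero>\<^bsub>H2 L\<^esub>" if X: "X \<in> carrier (H2 L)" and 0: "\<And>i. i \<in> I \<Longrightarrow> f i X = 0" for X
  proof -
    from X obtain \<phi> where \<phi>: "\<phi> \<in> cocycles2 L" "X = cohomology_class L \<phi>"
      by (auto simp: carrier_H2)
    then have "\<phi> \<in> cohomology_class L (\<lambda>_ _. 0)"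
      using 0 ker by (simp add: f cohomology_class_zero)
    then show ?thesis
      using cohomology_class_cong \<phi>(2) cohomology_class_zero zero_H2 by metis
  qed
  have d: "f i ((cohomology_class L \<circ> b) j) = (if i = j then 1 else 0)" if "i \<in> I" "j \<in> I" for i j
    using that by (simp add: f dual)
  show "vectorspace.basis class_ring (H2 L) (cohomology_class L ` b ` I)"
    using basis_of_dual_functionals(1)[OF H2 finI cls, of f] * ** d by (simp add: image_comp)
  show "vectorspace.dim class_ring (H2 L) = card I"
    using basis_of_dual_functionals(2)[OF H2 finI cls, of f] * ** d by simp
qed

section \<open>Forms on \<open>m0\<close> in coordinates\<close>

lemma m0_simps [simp]:
  "carrier (m0 p lam) = carrier_vec p" "\<zero>\<^bsub>m0 p lam\<^esub> = 0\<^sub>v p" "x \<oplus>\<^bsub>m0 p lam\<^esub> y = x + y"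
  "c \<odot>\<^bsub>m0 p lam\<^esub> x = c \<cdot>\<^sub>v x" "bracket (m0 p lam) = m0_bracket p"
  by (simp_all add: m0_def)

lemma m0_basis_closed [simp]: "m0_basis p k \<in> carrier_vec p"
  by (simp add: m0_basis_def)

lemma m0_bracket_closed [simp]: "m0_bracket p x y \<in> carrier_vec p"
  by (simp add: m0_bracket_def)

lemma smult_0_zero_vec: "0 \<cdot>\<^sub>v 0\<^sub>v p = (0\<^sub>v p :: 'a::field vec)"
  by (intro eq_vecI) auto

text \<open>Induction on the number \<open>n\<close> of coordinates kept: passing from
  \<open>n\<close> to \<open>n + 1\<close> adds \<open>x $ n\<close> times the basis vector with
  index \<open>n + 1\<close>, because vector entries are counted from 0.\<close>

lemma linear_form_expansion:
  fixes f :: "'a::field vec \<Rightarrow> 'a"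
  assumes add: "\<And>x y. \<lbrakk>x \<in> carrier_vec p; y \<in> carrier_vec p\<rbrakk> \<Longrightarrow> f (x + y) = f x + f y"
    and smult: "\<And>c x. x \<in> carrier_vec p \<Longrightarrow> f (c \<cdot>\<^sub>v x) = c * f x"
    and x: "x \<in> carrier_vec p"
  shows "f x = (\<Sum>i=1..p. x $ (i - 1) * f (m0_basis p i))"
proof -
  have "f (vec p (\<lambda>i. if i < n then x $ i else 0)) = (\<Sum>i=1..n. x $ (i - 1) * f (m0_basis p i))"
    if "n \<le> p" for n
    using that
  proof (induction n)
    case 0
    have "vec p (\<lambda>i. if i < 0 then x $ i else 0) = 0 \<cdot>\<^sub>v (0\<^sub>v p :: 'a vec)"
      by (intro eq_vecI) auto
    then show ?case using smult[of "0\<^sub>v p" 0] by simp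
  next
    case (Suc n)
    have "vec p (\<lambda>i. if i < Suc n then x $ i else 0) =
        vec p (\<lambda>i. if i < n then x $ i else 0) + x $ n \<cdot>\<^sub>v m0_basis p (Suc n)"
      using Suc.prems by (intro eq_vecI) (auto simp: m0_basis_def less_Suc_eq)
    then show ?case using Suc by (simp add: add smult)
  qed
  moreover have "vec p (\<lambda>i. if i < p then x $ i else 0) = x"
    using x by (intro eq_vecI) auto
  ultimately show ?thesis
    by (metis order_refl)
qed

lemma alternating_forms2D:
  assumes "\<phi> \<in> alternating_forms2 (m0 p lam)"
  shows "\<lbrakk>x \<in> carrier_vec p; y \<in> carrier_vec p; z \<in> carrier_vec p\<rbrakk> \<Longrightarrow> \<phi> (x + y) z = \<phi> x z + \<phi> y z"
    and "\<lbrakk>x \<in> carrier_vec p; y \<in> carrier_vec p; z \<in> carrier_vec p\<rbrakk> \<Longrightarrow> \<phi> x (y + z) = \<phi> x y + \<phi> x z"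
    and "\<lbrakk>x \<in> carrier_vec p; y \<in> carrier_vec p\<rbrakk> \<Longrightarrow> \<phi> (c \<cdot>\<^sub>v x) y = c * \<phi> x y"
    and "\<lbrakk>x \<in> carrier_vec p; y \<in> carrier_vec p\<rbrakk> \<Longrightarrow> \<phi> x (c \<cdot>\<^sub>v y) = c * \<phi> x y"
    and "x \<in> carrier_vec p \<Longrightarrow> \<phi> x x = 0"
    and "x \<notin> carrier_vec p \<or> y \<notin> carrier_vec p \<Longrightarrow> \<phi> x y = 0"
  using assms by (auto simp: alternating_forms2_def)

lemma alternating_forms2_zero_left:
  fixes lam :: "'a::field vec"
  assumes "\<phi> \<in> alternating_forms2 (m0 p lam)"
  shows "\<phi> (0\<^sub>v p) x = 0"
proof (cases "x \<in> carrier_vec p")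
  case True
  then show ?thesis
    using alternating_forms2D(3)[OF assms _ True, of "0\<^sub>v p" 0] by (simp add: smult_0_zero_vec)
qed (simp add: alternating_forms2D(6)[OF assms])

lemma alternating_forms2_antisym:
  assumes \<phi>: "\<phi> \<in> alternating_forms2 (m0 p lam)" and xy: "x \<in> carrier_vec p" "y \<in> carrier_vec p"
  shows "\<phi> y x = - \<phi> x y"
  using alternating_forms2D(5)[OF \<phi>, of "x + y"] xy
    alternating_forms2D(5)[OF \<phi> xy(1)] alternating_forms2D(5)[OF \<phi> xy(2)]
  by (simp add: alternating_forms2D(1,2)[OF \<phi>] eq_neg_iff_add_eq_0 add.commute)

text \<open>Expanding in both arguments reduces equality to pairs of basis vectors; the diagonal
  vanishes and antisymmetry settles the pairs with \<open>i > j\<close>. Off the carrier both forms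
  are 0.\<close>

lemma alternating_forms2_eqI:
  assumes \<phi>: "\<phi> \<in> alternating_forms2 (m0 p lam)" and \<chi>: "\<chi> \<in> alternating_forms2 (m0 p lam)"
    and eq: "\<And>i j. \<lbrakk>1 \<le> i; i < j; j \<le> p\<rbrakk> \<Longrightarrow>
      \<phi> (m0_basis p i) (m0_basis p j) = \<chi> (m0_basis p i) (m0_basis p j)"
  shows "\<phi> = \<chi>"
proof (intro ext)
  fix x y :: "'a vec"
  have exp: "\<theta> x y = (\<Sum>i=1..p. x $ (i - 1) * (\<Sum>j=1..p. y $ (j - 1) * \<theta> (m0_basis p i) (m0_basis p j)))"
    if \<theta>: "\<theta> \<in> alternating_forms2 (m0 p lam)" and xy: "x \<in> carrier_vec p" "y \<in> carrier_vec p" for \<theta>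
  proof -
    have "\<theta> x y = (\<Sum>i=1..p. x $ (i - 1) * \<theta> (m0_basis p i) y)"
      by (rule linear_form_expansion[where f = "\<lambda>x. \<theta> x y"]) (simp_all add: xy alternating_forms2D[OF \<theta>])
    moreover have "\<theta> e y = (\<Sum>j=1..p. y $ (j - 1) * \<theta> e (m0_basis p j))" if "e \<in> carrier_vec p" for e
      by (rule linear_form_expansion) (simp_all add: that xy alternating_forms2D[OF \<theta>])
    ultimately show ?thesis by simp
  qed
  have "\<phi> (m0_basis p i) (m0_basis p j) = \<chi> (m0_basis p i) (m0_basis p j)"
    if "i \<in> {1..p}" "j \<in> {1..p}" for i j
    using that
  proof (induction i j rule: linorder_wlog)
    case (le i j)
    then show ?case
      using eq by (cases "i = j") (auto simp: alternating_forms2D(5)[OF \<phi>] alternating_forms2D(5)[OF \<chi>])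
  next
    case (sym i j)
    then show ?case
      by (simp add: alternating_forms2_antisym[OF \<phi>, of "m0_basis p i"]
          alternating_forms2_antisym[OF \<chi>, of "m0_basis p i"])
  qed
  then show "\<phi> x y = \<chi> x y"
    by (cases "x \<in> carrier_vec p \<and> y \<in> carrier_vec p")
      (auto simp: exp[OF \<phi>] exp[OF \<chi>] alternating_forms2D(6)[OF \<phi>] alternating_forms2D(6)[OF \<chi>])
qed

lemma d1_alternating:
  fixes lam :: "'a::field vec"
  assumes \<psi>: "\<psi> \<in> cochains1 (m0 p lam)"
  shows "d1 (m0 p lam) \<psi> \<in> alternating_forms2 (m0 p lam)"
proof -
  interpret lie_algebra class_ring "m0 p lam" by (rule lie_algebra_m0)
  have add: "\<psi> (x + y) = \<psi> x + \<psi> y" if "x \<in> carrier_vec p" "y \<in> carrier_vec p" for x y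
    using \<psi> that by (simp add: cochains1_def)
  have smult: "\<psi> (c \<cdot>\<^sub>v x) = c * \<psi> x" if "x \<in> carrier_vec p" for x c
    using \<psi> that by (simp add: cochains1_def)
  have zero: "\<psi> (0\<^sub>v p) = 0"
    using smult[of "0\<^sub>v p" 0] by (simp add: smult_0_zero_vec)
  show ?thesis
    using bracket_add_left bracket_add_right bracket_smult_left bracket_smult_right bracket_self
    by (auto simp: alternating_forms2_def d1_def add smult zero)
qed

section \<open>The explicit cocycles\<close>

lemma e2_alternating: "\<lbrakk>i \<in> {1..p}; j \<in> {1..p}\<rbrakk> \<Longrightarrow> e2 p i j \<in> alternating_forms2 (m0 p lam)"
  by (auto simp: alternating_forms2_def e2_def algebra_simps)

text \<open>A bracket has no component at the first basis vector, so the form on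
  \<open>[g, h]\<close> and \<open>f\<close> is minus the first coordinate of \<open>f\<close> times
  the last coordinate of \<open>[g, h]\<close>. Expanding the last coordinates makes the three terms
  of the differential cancel.\<close>

lemma e2_1p_cocycle:
  assumes "p \<ge> 2"
  shows "e2 p 1 p \<in> cocycles2 (m0 p lam)"
proof -
  have "d2 (m0 p lam) (e2 p 1 p) = (\<lambda>_ _ _. 0)"
    using assms by (auto simp: d2_def e2_def m0_bracket_index fun_eq_iff algebra_simps)
  then show ?thesis
    using assms by (simp add: cocycles2_def cochains2_def e2_alternating)
qed

text \<open>The negative halves of the \<open>e2\<close> terms become the second half of the
  antidiagonal under \<open>i \<mapsto> k - i\<close>; for odd \<open>k\<close> this reflection
  flips the sign of \<open>(-1)^i\<close> and so absorbs the minus. The uniform sum is easier to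
  reindex than the definition of \<open>phi\<close>.\<close>

lemma phi_eq_antidiagonal_sum:
  assumes "odd k" "x \<in> carrier_vec p" "y \<in> carrier_vec p"
  shows "phi p k x y = (\<Sum>i=2..k-2. (-1)^i * x $ (i - 1) * y $ (k - i - 1))"
proof -
  obtain m where k: "k = 2 * m + 1" using assms(1) by (auto elim: oddE)
  let ?t = "\<lambda>i. (-1)^i * x $ (i - 1) * y $ (k - i - 1)"
  have "phi p k x y = (\<Sum>i=2..m. ?t i) + (\<Sum>i=2..m. - ((-1)^i) * x $ (k - i - 1) * y $ (i - 1))"
    using assms by (simp add: phi_def e2_def k sum.distrib[symmetric] algebra_simps)
  also have "(\<Sum>i=2..m. - ((-1)^i) * x $ (k - i - 1) * y $ (i - 1)) = (\<Sum>i=m+1..k-2. ?t i)"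
    by (rule sum.reindex_bij_witness[of _ "\<lambda>i. k - i" "\<lambda>i. k - i"])
      (auto simp: k uminus_power_if)
  also have "(\<Sum>i=2..m. ?t i) + (\<Sum>i=m+1..k-2. ?t i) = (\<Sum>i=2..k-2. ?t i)"
  \<comment> \<open>For \<open>m < 2\<close> all three ranges are empty, including the case
    \<open>k = 1\<close>, where \<open>k - 2\<close> truncates to 0.\<close>
  proof (cases "m < 2")
    case False
    then show ?thesis
      using sum.ub_add_nat[of 2 m ?t "m - 1"] by (simp add: k Suc_diff_le numeral_2_eq_2)
  qed (auto simp: k)
  finally show ?thesis .
qed

lemma phi_alternating:
  assumes "5 \<le> k" "k \<le> p + 2"
  shows "phi p k \<in> alternating_forms2 (m0 p lam)"
proof -
  have e: "e2 p i (k - i) \<in> alternating_forms2 (m0 p lam)" if "i \<in> {2..k div 2}" for i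
    using that assms by (intro e2_alternating) auto
  show ?thesis
    unfolding alternating_forms2_def phi_def
    by (auto simp: alternating_forms2D[OF e] algebra_simps sum.distrib sum_distrib_left)
qed

text \<open>With \<open>T(x, y)\<close> as in the proof, \<open>phi p k [g, h] f\<close> equals \<open>g\<^sub>1 T(h, f) - h\<^sub>1 T(g, f)\<close>, and
  the reflection \<open>i \<mapsto> k + 1 - i\<close> shows that \<open>T\<close> is symmetric, so the differential cancels.\<close>

lemma phi_cocycle:
  assumes k: "odd k" "5 \<le> k" "k \<le> p + 2"
  shows "phi p k \<in> cocycles2 (m0 p (lam :: 'a::field vec))"
proof -
  define T where "T x y = (\<Sum>i=3..k-2. (-1)^i * x $ (i - 2) * y $ (k - i - 1))" for x y :: "'a vec"
  have sym: "T x y = T y x" for x y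
    unfolding T_def
    by (rule sum.reindex_bij_witness[of _ "\<lambda>i. k + 1 - i" "\<lambda>i. k + 1 - i"])
      (use k in \<open>auto simp: uminus_power_if Suc_diff_le diff_diff_eq\<close>)
  have bracket: "phi p k (m0_bracket p g h) f = g $ 0 * T h f - h $ 0 * T g f"
    if "f \<in> carrier_vec p" for g h f :: "'a vec"
  proof -
    have "phi p k (m0_bracket p g h) f =
        (\<Sum>i=2..k-2. (-1)^i * m0_bracket p g h $ (i - 1) * f $ (k - i - 1))"
      using that k by (intro phi_eq_antidiagonal_sum) auto
    \<comment> \<open>The term \<open>i = 2\<close> drops out: brackets lie in the span of the basis
      vectors from the third onwards.\<close>
    also have "\<dots> = (\<Sum>i=3..k-2. (-1)^i * m0_bracket p g h $ (i - 1) * f $ (k - i - 1))"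
      using k by (intro sum.mono_neutral_right) (auto simp: m0_bracket_index)
    also have "\<dots> = (\<Sum>i=3..k-2. g $ 0 * ((-1)^i * h $ (i - 2) * f $ (k - i - 1))
        - h $ 0 * ((-1)^i * g $ (i - 2) * f $ (k - i - 1)))"
      using k by (intro sum.cong) (auto simp: m0_bracket_index algebra_simps numeral_2_eq_2)
    finally show ?thesis
      by (simp add: T_def sum_subtractf sum_distrib_left)
  qed
  have "d2 (m0 p lam) (phi p k) = (\<lambda>_ _ _. 0)"
    using sym by (auto simp: d2_def fun_eq_iff bracket)
  then show ?thesis
    using k by (simp add: cocycles2_def cochains2_def phi_alternating)
qed

text \<open>This supplies the duality: in row \<open>i = 2\<close> the sign is 1, so
  \<open>phi p (l + 2)\<close> takes the value 1 exactly at column \<open>l\<close>, while row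
  \<open>i = 1\<close> vanishes and keeps \<open>phi\<close> invisible to the functional that
  detects \<open>e2 p 1 p\<close>.\<close>

lemma phi_basis:
  assumes "odd k" "5 \<le> k" "k \<le> p + 2" "1 \<le> i" "i \<le> p" "1 \<le> j" "j \<le> p"
  shows "phi p k (m0_basis p i) (m0_basis p j) =
    (if 2 \<le> i \<and> 2 \<le> j \<and> i + j = k then (-1)^i else 0 :: 'a::field)"
proof -
  have "phi p k (m0_basis p i) (m0_basis p j) =
      (\<Sum>l=2..k-2. (-1)^l * m0_basis p i $ (l - 1) * (m0_basis p j $ (k - l - 1) :: 'a))"
    using assms by (intro phi_eq_antidiagonal_sum) auto
  also have "\<dots> = (\<Sum>l=2..k-2. if l = i then if i + j = k then (-1)^i else 0 else 0)"
    using assms by (intro sum.cong) (auto simp: m0_basis_def)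
  finally show ?thesis
    using assms by auto
qed

section \<open>Values of cocycles and coboundaries on basis vectors\<close>

text \<open>This is the cocycle condition on the basis vectors with indices 1, \<open>i\<close>,
  \<open>j\<close>. The last two commute, so two terms remain; at \<open>j = p\<close> a further
  bracket vanishes, which is the boundary case with value 0.\<close>

lemma cocycle_basis:
  fixes lam :: "'a::field vec"
  assumes \<phi>: "\<phi> \<in> cocycles2 (m0 p lam)" and i: "2 \<le> i" "i < p" and j: "2 \<le> j" "j \<le> p"
  shows "\<phi> (m0_basis p (i + 1)) (m0_basis p j) =
    (if j < p then - \<phi> (m0_basis p i) (m0_basis p (j + 1)) else 0)"
proof -
  have alt: "\<phi> \<in> alternating_forms2 (m0 p lam)"
    using \<phi> by (simp add: cocycles2_def cochains2_def)
  let ?e = "m0_basis p :: nat \<Rightarrow> 'a vec"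
  have "d2 (m0 p lam) \<phi> (?e 1) (?e i) (?e j) = 0"
    using \<phi> by (simp add: cocycles2_def)
  then have "\<phi> (m0_basis_bracket p 1 i) (?e j) - \<phi> (m0_basis_bracket p 1 j) (?e i)
      + \<phi> (m0_basis_bracket p i j) (?e 1) = 0"
    using i j m0_bracket_basis[of 1 p i, where 'a = 'a] m0_bracket_basis[of 1 p j, where 'a = 'a]
      m0_bracket_basis[of i p j, where 'a = 'a]
    by (simp add: d2_def)
  then show ?thesis
    using i j alternating_forms2_antisym[OF alt, of "?e i" "?e (j + 1)"]
    by (auto simp: m0_basis_bracket_def alternating_forms2_zero_left[OF alt] eq_neg_iff_add_eq_0)
qed

text \<open>The cocycle relation propagates values along antidiagonals; an antidiagonal with even index
  sum meets the diagonal, where an alternating form vanishes.\<close>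

lemma cocycle_basis_eq_0:
  fixes lam :: "'a::field vec"
  assumes \<phi>: "\<phi> \<in> cocycles2 (m0 p lam)"
    and 0: "\<And>j. \<lbrakk>odd j; 3 \<le> j; j \<le> p\<rbrakk> \<Longrightarrow> \<phi> (m0_basis p 2) (m0_basis p j) = 0"
    and ij: "2 \<le> i" "i \<le> p" "2 \<le> j" "j \<le> p"
  shows "\<phi> (m0_basis p i) (m0_basis p j) = 0"
proof -
  have alt: "\<phi> \<in> alternating_forms2 (m0 p lam)"
    using \<phi> by (simp add: cocycles2_def cochains2_def)
  let ?a = "\<lambda>i j. \<phi> (m0_basis p i) (m0_basis p j)"
  have shift: "?a (t + 2) j = (-1)^t * ?a 2 (j + t)" if "2 \<le> j" "j + t \<le> p" for t j
    using that
  proof (induction t arbitrary: j)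
    case (Suc t)
    then show ?case
      using cocycle_basis[OF \<phi>, of "t + 2" j] Suc.IH[of "Suc j"] by simp
  qed (simp add: numeral_2_eq_2)
  have row2: "?a 2 j = 0" if "2 \<le> j" "j \<le> p" for j
  proof (cases "odd j")
    case True
    then show ?thesis using 0[of j] that by (cases "j = 2") auto
  next
    case False
    then obtain m where "j = 2 * m" by auto
    \<comment> \<open>For even \<open>j = 2 + t + t\<close>, moving \<open>t\<close> steps along the
      antidiagonal from position \<open>(2, j)\<close> lands on the diagonal at
      \<open>(t + 2, t + 2)\<close>.\<close>
    then have "j = 2 + (m - 1) + (m - 1)"
      using that by auto
    then obtain t where "j = 2 + t + t" ..
    then show ?thesis
      using shift[of "2 + t" t] that alternating_forms2D(5)[OF alt, of "m0_basis p (t + 2)"]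
      by (simp add: add.commute)
  qed
  show ?thesis
    using ij
  \<comment> \<open>The column must vary: row \<open>i + 1\<close> reduces to row \<open>i\<close>
    one column further on, or to 0 when \<open>j = p\<close>.\<close>
  proof (induction i arbitrary: j rule: dec_induct)
    case base
    then show ?case using row2 by simp
  next
    case (step i)
    then show ?case using cocycle_basis[OF \<phi>, of i j] by simp
  qed
qed

text \<open>In each of these positions the two basis vectors commute, so a coboundary evaluates its
  1-cochain at the zero vector.\<close>

lemma coboundary_basis_eq_0:
  fixes lam :: "'a::field vec"
  assumes \<beta>: "\<beta> \<in> coboundaries2 (m0 p lam)" and "1 \<le> i" "i \<le> p" "1 \<le> j" "j \<le> p"
    and ij: "2 \<le> i \<and> 2 \<le> j \<or> i = 1 \<and> j = p"
  shows "\<beta> (m0_basis p i) (m0_basis p j) = 0"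
proof -
  from \<beta> obtain \<psi> where \<psi>: "\<psi> \<in> cochains1 (m0 p lam)" "\<beta> = d1 (m0 p lam) \<psi>"
    by (auto simp: coboundaries2_def)
  have "\<psi> (0 \<cdot>\<^sub>v 0\<^sub>v p) = 0 * \<psi> (0\<^sub>v p)"
    using \<psi>(1) unfolding cochains1_def by auto
  then have "\<psi> (0\<^sub>v p) = 0"
    by (simp add: smult_0_zero_vec)
  moreover have "m0_bracket p (m0_basis p i) (m0_basis p j) = (0\<^sub>v p :: 'a vec)"
    using assms m0_bracket_basis[of i p j, where 'a = 'a] by (auto simp: m0_basis_bracket_def)
  ultimately show ?thesis
    by (simp add: \<psi>(2) d1_def)
qed

text \<open>The hypotheses leave only the values at \<open>(1, j)\<close> with \<open>j < p\<close>.
  A primitive \<open>\<psi>\<close> must send the basis vector \<open>j + 1\<close> to such a value,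
  and these prescriptions for distinct \<open>j\<close> are independent.\<close>

lemma cocycle_in_coboundaries2:
  fixes lam :: "'a::field vec"
  assumes \<phi>: "\<phi> \<in> cocycles2 (m0 p lam)"
    and 1: "\<phi> (m0_basis p 1) (m0_basis p p) = 0"
    and 2: "\<And>j. \<lbrakk>odd j; 3 \<le> j; j \<le> p\<rbrakk> \<Longrightarrow> \<phi> (m0_basis p 2) (m0_basis p j) = 0"
  shows "\<phi> \<in> coboundaries2 (m0 p lam)"
proof -
  have alt: "\<phi> \<in> alternating_forms2 (m0 p lam)"
    using \<phi> by (simp add: cocycles2_def cochains2_def)
  \<comment> \<open>The sum starts at 3 because brackets have no components at the first two basis
    vectors; there \<open>\<psi>\<close> is set to 0.\<close>
  define \<psi> where "\<psi> x = (if x \<in> carrier_vec p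
    then \<Sum>k=3..p. x $ (k - 1) * \<phi> (m0_basis p 1) (m0_basis p (k - 1)) else 0)" for x
  have \<psi>: "\<psi> \<in> cochains1 (m0 p lam)"
  proof -
    have "(\<Sum>k=3..p. (x + y) $ (k - 1) * a k) = (\<Sum>k=3..p. x $ (k - 1) * a k) + (\<Sum>k=3..p. y $ (k - 1) * a k)"
      if "x \<in> carrier_vec p" "y \<in> carrier_vec p" for x y :: "'a vec" and a
      unfolding sum.distrib[symmetric] using that by (intro sum.cong) (auto simp: distrib_right)
    moreover have "(\<Sum>k=3..p. (c \<cdot>\<^sub>v x) $ (k - 1) * a k) = c * (\<Sum>k=3..p. x $ (k - 1) * a k)"
      if "x \<in> carrier_vec p" for c and x :: "'a vec" and a
      unfolding sum_distrib_left using that by (intro sum.cong) (auto simp: mult.assoc)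
    ultimately show ?thesis by (simp add: cochains1_def \<psi>_def)
  qed
  have \<psi>_basis: "\<psi> (m0_basis p l) = \<phi> (m0_basis p 1) (m0_basis p (l - 1))" if "3 \<le> l" "l \<le> p" for l
  proof -
    have "\<psi> (m0_basis p l) = (\<Sum>k=3..p. if k = l then \<phi> (m0_basis p 1) (m0_basis p (l - 1)) else 0)"
      unfolding \<psi>_def if_P[OF m0_basis_closed]
      using that by (intro sum.cong) (auto simp: m0_basis_def)
    then show ?thesis using that by simp
  qed
  have "\<phi> = d1 (m0 p lam) \<psi>"
  proof (rule alternating_forms2_eqI[OF alt d1_alternating[OF \<psi>]])
    fix i j assume ij: "1 \<le> i" "i < j" "j \<le> p"
    consider "2 \<le> i" | "i = 1" "j = p" | "i = 1" "j < p"
      using ij by linarith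
    then show "\<phi> (m0_basis p i) (m0_basis p j) = d1 (m0 p lam) \<psi> (m0_basis p i) (m0_basis p j)"
    proof cases
      case 3
      then have "d1 (m0 p lam) \<psi> (m0_basis p i) (m0_basis p j) = \<psi> (m0_basis p (j + 1))"
        using ij m0_bracket_basis[of i p j, where 'a = 'a] by (simp add: d1_def m0_basis_bracket_def)
      then show ?thesis
        using 3 ij by (simp add: \<psi>_basis)
    qed (use ij \<psi> coboundary_basis_eq_0[of "d1 (m0 p lam) \<psi>" p lam i j]
        cocycle_basis_eq_0[OF \<phi> 2, of i j] 1 in \<open>auto simp: coboundaries2_def\<close>)
  qed
  with \<psi> show ?thesis by (auto simp: coboundaries2_def)
qed

section \<open>The basis of the second cohomology\<close>

text \<open>Index 1 stands for \<open>e2 p 1 p\<close>, detected at the basis vectors 1 and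
  \<open>p\<close>; an odd index \<open>k \<ge> 3\<close> stands for \<open>phi p (k + 2)\<close>,
  detected at 2 and \<open>k\<close>. Both cases of the theorem draw on this: for
  \<open>p = 2\<close> the index set is \<open>{1}\<close>.\<close>

lemma H2_m0_basis:
  fixes lam :: "'a::field vec"
  assumes p: "2 \<le> p"
  defines "I \<equiv> {k. odd k \<and> k \<le> p}" and "b \<equiv> \<lambda>k. if k = 1 then e2 p 1 p else phi p (k + 2)"
  shows "vectorspace.basis class_ring (H2 (m0 p lam)) (cohomology_class (m0 p lam) ` b ` I)"
    and "vectorspace.dim class_ring (H2 (m0 p lam)) = card I"
proof -
  let ?e = "m0_basis p :: nat \<Rightarrow> 'a vec"
  define F :: "nat \<Rightarrow> ('a vec \<Rightarrow> 'a vec \<Rightarrow> 'a) \<Rightarrow> 'a"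
    where "F k \<phi> = (if k = 1 then \<phi> (?e 1) (?e p) else \<phi> (?e 2) (?e k))" for k \<phi>
  have I: "k = 1 \<or> odd k \<and> 3 \<le> k \<and> k \<le> p" if "k \<in> I" for k
    using that by (auto simp: I_def) presburger
  have fin: "finite I"
    by (simp add: I_def)
  have b: "b ` I \<subseteq> cocycles2 (m0 p lam)"
    using p by (auto dest!: I simp: b_def e2_1p_cocycle[simplified] phi_cocycle)
  have dual: "F i (b j) = (if i = j then 1 else 0)" if "i \<in> I" "j \<in> I" for i j
    using I[OF that(1)] I[OF that(2)] p e2_dual_basis[of 1 p p 1 p, where 'a = 'a]
      e2_dual_basis[of 1 p p 2 i, where 'a = 'a]
    by (auto simp: F_def b_def phi_basis)
  have cobd: "F i \<beta> = 0" if "i \<in> I" "\<beta> \<in> coboundaries2 (m0 p lam)" for i \<beta>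
    using I[OF that(1)] p coboundary_basis_eq_0[OF that(2), of 1 p]
      coboundary_basis_eq_0[OF that(2), of 2 i]
    by (auto simp: F_def)
  have ker: "\<phi> \<in> coboundaries2 (m0 p lam)"
    if \<phi>: "\<phi> \<in> cocycles2 (m0 p lam)" and 0: "\<And>i. i \<in> I \<Longrightarrow> F i \<phi> = 0" for \<phi>
  proof (rule cocycle_in_coboundaries2[OF \<phi>])
    show "\<phi> (?e 1) (?e p) = 0"
      using 0[of 1] p by (simp add: I_def F_def)
    show "\<phi> (?e 2) (?e j) = 0" if "odd j" "3 \<le> j" "j \<le> p" for j
      using 0[of j] that by (simp add: I_def F_def)
  qed
  have lin: "F i (\<lambda>x y. \<phi> x y + \<chi> x y) = F i \<phi> + F i \<chi>" "F i (\<lambda>x y. c * \<phi> x y) = c * F i \<phi>"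
    for i \<phi> \<chi> c
    by (simp_all add: F_def)
  note H2_basis_of_dual_functionals[where F = F, OF lie_algebra_m0 fin b lin cobd dual ker]
  then show "vectorspace.basis class_ring (H2 (m0 p lam)) (cohomology_class (m0 p lam) ` b ` I)"
    and "vectorspace.dim class_ring (H2 (m0 p lam)) = card I"
    by blast+
qed

section \<open>The case \<open>p = 2\<close>\<close>

text \<open>With no nonzero coboundaries every class is a singleton, so \<open>the_elem\<close> is
  the isomorphism.\<close>

lemma isomorphic_spaces_H2_cochains2:
  assumes L: "lie_algebra class_ring L"
    and Z: "cocycles2 L = alternating_forms2 L" and B: "coboundaries2 L = {\<lambda>_ _. 0}"
  shows "isomorphic_spaces (H2 L) (cochains2 L)"
proof -
  have [simp]: "cohomology_class L \<phi> = {\<phi>}" for \<phi>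
    by (auto simp: cohomology_class_iff B fun_eq_iff)
  have carrier: "carrier (H2 L) = (\<lambda>\<phi>. {\<phi>}) ` alternating_forms2 L"
    by (simp add: carrier_H2 Z)
  have ops: "{\<phi>} \<oplus>\<^bsub>H2 L\<^esub> {\<chi>} = {\<lambda>x y. \<phi> x y + \<chi> x y}" "c \<odot>\<^bsub>H2 L\<^esub> {\<phi>} = {\<lambda>x y. c * \<phi> x y}" for \<phi> \<chi> c
    using add_H2[of L \<phi> \<chi>] smult_H2[of L c \<phi>] by simp_all
  have "the_elem \<in> LinearCombinations.module_hom class_ring (H2 L) (cochains2 L)"
    by (auto simp: LinearCombinations.module_hom_def carrier ops cochains2_def)
  then have "linear_map class_ring (H2 L) (cochains2 L) the_elem"
    using vectorspace_H2[OF L] vectorspace_cochains2[of L]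
    by (intro linear_map.intro mod_hom.intro mod_hom_axioms.intro) (auto simp: vectorspace_def)
  moreover have "bij_betw the_elem (carrier (H2 L)) (carrier (cochains2 L))"
    by (auto simp: bij_betw_def inj_on_def carrier cochains2_def image_image)
  ultimately show ?thesis
    by (auto simp: isomorphic_spaces_def)
qed

lemma coboundaries2_m0_2: "coboundaries2 (m0 2 lam) = {\<lambda>_ _. 0}"
proof -
  have "\<beta> = (\<lambda>_ _. 0)" if \<beta>: "\<beta> \<in> coboundaries2 (m0 2 lam)" for \<beta>
  proof (rule alternating_forms2_eqI)
    show "\<beta> \<in> alternating_forms2 (m0 2 lam)"
      using \<beta> by (auto simp: coboundaries2_def d1_alternating)
    show "(\<lambda>_ _. 0) \<in> alternating_forms2 (m0 2 lam)"
      by (simp add: alternating_forms2_def)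
    show "\<beta> (m0_basis 2 i) (m0_basis 2 j) = 0" if "1 \<le> i" "i < j" "j \<le> 2" for i j
      using that by (intro coboundary_basis_eq_0[OF \<beta>]) auto
  qed
  then show ?thesis
    using coboundaries2_zero by blast
qed

text \<open>For \<open>p = 2\<close> the algebra is abelian, since a bracket can be nonzero only
  from the third coordinate on; hence the differential vanishes.\<close>

lemma cocycles2_m0_2:
  fixes lam :: "'a::field vec"
  shows "cocycles2 (m0 2 lam) = alternating_forms2 (m0 2 lam)"
proof -
  have "m0_bracket 2 x y = 0\<^sub>v 2" for x y :: "'a vec"
    by (rule eq_vecI) (auto simp: m0_bracket_index carrier_vecD[OF m0_bracket_closed])
  then show ?thesis
    by (auto simp: cocycles2_def cochains2_def d2_def fun_eq_iff alternating_forms2_zero_left)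
qed

lemma cochains2_m0_2_basis:
  fixes lam :: "'a::field vec"
  shows "vectorspace.basis class_ring (cochains2 (m0 2 lam)) {e2 2 1 2}"
    and "vectorspace.dim class_ring (cochains2 (m0 2 lam)) = 1"
proof -
  let ?V = "cochains2 (m0 2 lam)"
  \<comment> \<open>The dual-functional criterion is applied with a one-element index set:
    evaluation at the two basis vectors is dual to \<open>e2 2 1 2\<close>.\<close>
  define f :: "unit \<Rightarrow> ('a vec \<Rightarrow> 'a vec \<Rightarrow> 'a) \<Rightarrow> 'a"
    where "f i \<phi> = \<phi> (m0_basis 2 1) (m0_basis 2 2)" for i \<phi>
  have e2: "(\<lambda>_. e2 2 1 2) ` {()} \<subseteq> carrier ?V"
    by (simp add: cochains2_def e2_alternating)
  have ker: "\<phi> = \<zero>\<^bsub>?V\<^esub>" if "\<phi> \<in> carrier ?V" "\<And>i. i \<in> {()} \<Longrightarrow> f i \<phi> = 0" for \<phi>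
  proof (rule alternating_forms2_eqI)
    show "\<phi> \<in> alternating_forms2 (m0 2 lam)" "\<zero>\<^bsub>?V\<^esub> \<in> alternating_forms2 (m0 2 lam)"
      using that(1) by (simp_all add: cochains2_def alternating_forms2_def)
    show "\<phi> (m0_basis 2 i) (m0_basis 2 j) = \<zero>\<^bsub>?V\<^esub> (m0_basis 2 i) (m0_basis 2 j)"
      if "1 \<le> i" "i < j" "j \<le> 2" for i j
    proof -
      have "i = 1" "j = 2" using that by auto
      then show ?thesis
        using \<open>\<And>i. i \<in> {()} \<Longrightarrow> f i \<phi> = 0\<close> by (simp add: f_def cochains2_def)
    qed
  qed
  have lin: "f i (\<phi> \<oplus>\<^bsub>?V\<^esub> \<chi>) = f i \<phi> + f i \<chi>" "f i (c \<odot>\<^bsub>?V\<^esub> \<phi>) = c * f i \<phi>" for i \<phi> \<chi> c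
    by (simp_all add: f_def cochains2_def)
  have dual: "f i (e2 2 1 2) = (if i = j then 1 else 0)" for i j
    using e2_dual_basis[of 1 2 2 1 2, where 'a = 'a] by (simp add: f_def)
  have "vectorspace.basis class_ring ?V ((\<lambda>_. e2 2 1 2) ` {()})"
    by (rule basis_of_dual_functionals(1)[where f = f, OF vectorspace_cochains2 _ e2])
      (simp, (rule lin dual ker; assumption?)+)
  then show "vectorspace.basis class_ring ?V {e2 2 1 2}" by simp
  have "vectorspace.dim class_ring ?V = card {()}"
    by (rule basis_of_dual_functionals(2)[where f = f, OF vectorspace_cochains2 _ e2])
      (simp, (rule lin dual ker; assumption?)+)
  then show "vectorspace.dim class_ring ?V = 1" by simp
qed

theorem theorem4p1:
  fixes p :: nat and lam :: "'a::field vec"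
  assumes "prime p" and "CHAR('a) = p" and "lam \<in> carrier_vec p"
  shows "(p = 2 \<longrightarrow>
            isomorphic_spaces (H2 (m0 p lam)) (cochains2 (m0 p lam)) \<and>
            carrier (cochains2 (m0 p lam)) =
              LinearCombinations.module.span class_ring (cochains2 (m0 p lam)) {e2 p 1 2} \<and>
            vectorspace.dim class_ring (cochains2 (m0 p lam)) = 1 \<and>
            vectorspace.dim class_ring (H2 (m0 p lam)) = 1) \<and>
         (p \<ge> 3 \<longrightarrow>
            real (vectorspace.dim class_ring (H2 (m0 p lam))) = (real p + 1) / 2 \<and>
            e2 p 1 p \<in> cocycles2 (m0 p lam) \<and>
            (\<forall>k. odd k \<and> 5 \<le> k \<and> k \<le> p + 2 \<longrightarrow> phi p k \<in> cocycles2 (m0 p lam)) \<and>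
            vectorspace.basis class_ring (H2 (m0 p lam))
              (cohomology_class (m0 p lam) `
                insert (e2 p 1 p) {phi p k |k. odd k \<and> 5 \<le> k \<and> k \<le> p + 2}))"
proof (intro conjI impI)
  assume p: "p = 2"
  show "isomorphic_spaces (H2 (m0 p lam)) (cochains2 (m0 p lam))"
    unfolding p
    by (rule isomorphic_spaces_H2_cochains2[OF lie_algebra_m0 cocycles2_m0_2 coboundaries2_m0_2])
  interpret C: vectorspace class_ring "cochains2 (m0 2 lam)"
    by (rule vectorspace_cochains2)
  show "carrier (cochains2 (m0 p lam)) =
      LinearCombinations.module.span class_ring (cochains2 (m0 p lam)) {e2 p 1 2}"
    using cochains2_m0_2_basis(1)[of lam] by (simp add: p C.basis_def)
  show "vectorspace.dim class_ring (cochains2 (m0 p lam)) = 1"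
    using cochains2_m0_2_basis(2)[of lam] by (simp add: p)
  have "{k::nat. odd k \<and> k \<le> 2} = {1}"
    by (auto simp: le_Suc_eq numeral_2_eq_2)
  then show "vectorspace.dim class_ring (H2 (m0 p lam)) = 1"
    using H2_m0_basis(2)[of p lam] p by simp
next
  assume p: "p \<ge> 3"
  let ?I = "{k. odd k \<and> k \<le> p}" and ?b = "\<lambda>k. if k = 1 then e2 p 1 p else phi p (k + 2) :: 'a vec \<Rightarrow> 'a vec \<Rightarrow> 'a"
  have "odd p"
    using prime_odd_nat[OF assms(1)] p by simp
  then obtain m where m: "p = 2 * m + 1"
    by (auto elim: oddE)
  \<comment> \<open>Odd numbers up to \<open>2 * m + 1\<close> correspond to
    \<open>0, ..., m\<close>, which gives \<open>m + 1 = (p + 1) / 2\<close> basis classes.\<close>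
  have "?I = (\<lambda>i. 2 * i + 1) ` {..m}"
    by (auto simp: m elim!: oddE)
  then have "card ?I = m + 1"
    by (simp add: card_image inj_on_def)
  then show "real (vectorspace.dim class_ring (H2 (m0 p lam))) = (real p + 1) / 2"
    using H2_m0_basis(2)[of p lam] p by (simp add: m)
  show "e2 p 1 p \<in> cocycles2 (m0 p lam)"
    using p by (intro e2_1p_cocycle) simp
  show "\<forall>k. odd k \<and> 5 \<le> k \<and> k \<le> p + 2 \<longrightarrow> phi p k \<in> cocycles2 (m0 p lam)"
    by (simp add: phi_cocycle)
  \<comment> \<open>The superscript of \<open>phi\<close> is the index plus 2, so odd indices from 3
    to \<open>p\<close> match odd superscripts from 5 to \<open>p + 2\<close>.\<close>
  have "?b ` ?I = insert (e2 p 1 p) {phi p k |k. odd k \<and> 5 \<le> k \<and> k \<le> p + 2}"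
  proof (intro equalityI subsetI)
    fix \<phi> assume "\<phi> \<in> ?b ` ?I"
    then obtain k where k: "odd k" "k \<le> p" "\<phi> = ?b k" by blast
    show "\<phi> \<in> insert (e2 p 1 p) {phi p k |k. odd k \<and> 5 \<le> k \<and> k \<le> p + 2}"
    proof (cases "k = 1")
      case False
      then have "5 \<le> k + 2" using k(1) by presburger
      then show ?thesis using k False by auto
    qed (use k in simp)
  next
    fix \<phi> :: "'a vec \<Rightarrow> 'a vec \<Rightarrow> 'a"
    assume "\<phi> \<in> insert (e2 p 1 p) {phi p k |k. odd k \<and> 5 \<le> k \<and> k \<le> p + 2}"
    then consider "\<phi> = e2 p 1 p" | k where "odd k" "5 \<le> k" "k \<le> p + 2" "\<phi> = phi p k" by blast
    then show "\<phi> \<in> ?b ` ?I"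
    proof cases
      case 1
      then show ?thesis using p by (intro image_eqI[of _ _ 1]) auto
    next
      case 2
      then obtain l where "k = l + 2"
        using le_Suc_ex[of 2 k] by auto
      with 2 show ?thesis by (intro image_eqI[of _ _ l]) auto
    qed
  qed
  then show "vectorspace.basis class_ring (H2 (m0 p lam)) (cohomology_class (m0 p lam) `
      insert (e2 p 1 p) {phi p k |k. odd k \<and> 5 \<le> k \<and> k \<le> p + 2})"
    using H2_m0_basis(1)[of p lam] p by simp
qed

end
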